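(* Let $q\in\mathbb{C}^*$. Let $\tilde H(G_2)$ be the affine Hecke algebra of type $G_2$ and let $H(G_2)$ be the Iwahori–Hecke subalgebra of type $G_2$ generated by $T_1$ and $T_2$. There does not exist an algebra homomorphism $\Phi\colon\tilde H(G_2)\to H(G_2)$ such that $\Phi(T_i)=T_i$ for $1\le i\le2$.
   Context: For the root system of type $G_2$ the weight lattice and the root lattice coincide, and the affine Hecke algebra $\tilde H(G_2)$ is the $\mathbb{C}$-algebra with generators $T_0,T_1,T_2$ (invertible) and relations given by the braid relations of the extended Dynkin diagram in which nodes $1,2$ are joined by a triple edge, nodes $2,0$ by a single edge, and nodes $0,1$ are not joined, namely $T_1T_2T_1T_2T_1T_2=T_2T_1T_2T_1T_2T_1$, $T_0T_2T_0=T_2T_0T_2$, $T_0T_1=T_1T_0$, together with $(T_i-q)(T_i+q^{-1})=0$ for $i=0,1,2$.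
   Formalization: The hypothesis q^4 ≠ 1 is added: for q = ±1 the projection of the affine Weyl group onto the finite one (T_0 to the reflection in the highest root) gives such a homomorphism, and for q = ±i one also exists, so the claim fails exactly at these four values. *)

theory Defs
  imports
    Complex_Main
    "HOL-Library.Poly_Mapping"
    "HOL-Algebra.Module"
    "HOL-Algebra.Subrings"
begin

section \<open>Associative unital algebras over the complex numbers\<close>

text \<open>
  An algebra is given by the record \<^type>\<open>module\<close> of HOL-Algebra, i.e. a ring together with
  a scalar multiplication. (The locale \<^locale>\<open>algebra\<close> of HOL-Algebra only covers
  commutative algebras.)
\<close>

definition complex_field :: "complex ring" where
  "complex_field = \<lparr>carrier = UNIV, monoid.mult = (*), one = 1, zero = 0, add = (+)\<rparr>"

locale complex_algebra = module complex_field A + ring A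
  for A :: "(complex, 'a) module" (structure) +
  assumes smult_mult_left:
      "\<lbrakk>x \<in> carrier A; y \<in> carrier A\<rbrakk> \<Longrightarrow> (c \<odot> x) \<otimes> y = c \<odot> (x \<otimes> y)"
    and smult_mult_right:
      "\<lbrakk>x \<in> carrier A; y \<in> carrier A\<rbrakk> \<Longrightarrow> x \<otimes> (c \<odot> y) = c \<odot> (x \<otimes> y)"

definition alg_hom :: "(complex, 'a) module \<Rightarrow> (complex, 'b) module \<Rightarrow> ('a \<Rightarrow> 'b) set" where
  "alg_hom A B =
     {h \<in> ring_hom A B. \<forall>c. \<forall>x\<in>carrier A. h (c \<odot>\<^bsub>A\<^esub> x) = c \<odot>\<^bsub>B\<^esub> h x}"

definition is_subalgebra :: "(complex, 'a) module \<Rightarrow> 'a set \<Rightarrow> bool" where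
  "is_subalgebra A V \<longleftrightarrow> subring V A \<and> (\<forall>c. \<forall>x\<in>V. c \<odot>\<^bsub>A\<^esub> x \<in> V)"

definition generated_subalgebra :: "(complex, 'a) module \<Rightarrow> 'a set \<Rightarrow> (complex, 'a) module" where
  "generated_subalgebra A S = A\<lparr>carrier := \<Inter>{V. is_subalgebra A V \<and> S \<subseteq> V}\<rparr>"

definition quotient_algebra :: "(complex, 'a) module \<Rightarrow> 'a set \<Rightarrow> (complex, 'a set) module" where
  "quotient_algebra A I =
     ring.extend (A Quot I) (module.fields (\<lambda>c X. \<Union>x\<in>X. I +>\<^bsub>A\<^esub> (c \<odot>\<^bsub>A\<^esub> x)))"


section \<open>Free algebras\<close>

text \<open>
  The free algebra on a set of generators is the monoid algebra of the free monoid. The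
  multiplication of \<^type>\<open>poly_mapping\<close> is the convolution with respect to an \<^emph>\<open>additively\<close>
  written, not necessarily commutative, monoid of exponents. So concatenation of words
  is written as addition.
\<close>

datatype 'g word = Word (letters: "'g list")

instantiation word :: (type) monoid_add
begin

definition zero_word :: "'a word" where "0 = Word []"

definition plus_word :: "'a word \<Rightarrow> 'a word \<Rightarrow> 'a word" where
  "u + v = Word (letters u @ letters v)"

instance by standard (auto simp: zero_word_def plus_word_def)

end

type_synonym 'g free_alg = "'g word \<Rightarrow>\<^sub>0 complex"

definition gen :: "'g \<Rightarrow> 'g free_alg" where
  "gen g = Poly_Mapping.single (Word [g]) 1"

definition scalar :: "complex \<Rightarrow> 'g free_alg" where
  "scalar c = Poly_Mapping.single 0 c"

definition free_algebra :: "(complex, 'g free_alg) module" where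
  "free_algebra =
     \<lparr>carrier = UNIV, monoid.mult = (*), one = 1, zero = 0, add = (+), smult = (\<lambda>c x. scalar c * x)\<rparr>"

text \<open>The algebra with generators \<open>'g\<close> subject to the relations \<open>r = 0\<close> for \<open>r \<in> R\<close>.\<close>

definition presented_algebra :: "'g free_alg set \<Rightarrow> (complex, 'g free_alg set) module" where
  "presented_algebra R = quotient_algebra free_algebra (Idl\<^bsub>free_algebra\<^esub> R)"

definition presented_gen :: "'g free_alg set \<Rightarrow> 'g \<Rightarrow> 'g free_alg set" where
  "presented_gen R g = Idl\<^bsub>free_algebra\<^esub> R +>\<^bsub>free_algebra\<^esub> gen g"


section \<open>The affine Hecke algebra of type \<open>G\<^sub>2\<close>\<close>

text \<open>
  The nodes of the extended Dynkin diagram: \<open>N1\<close> and \<open>N2\<close> are joined by a triple edge, \<open>N2\<close> and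
  the affine node \<open>N0\<close> by a single edge.
\<close>

datatype node = N0 | N1 | N2

definition hecke_relations :: "complex \<Rightarrow> node free_alg set" where
  "hecke_relations q =
     (let t0 = gen N0; t1 = gen N1; t2 = gen N2 in
       {t1 * t2 * t1 * t2 * t1 * t2 - t2 * t1 * t2 * t1 * t2 * t1,
        t0 * t2 * t0 - t2 * t0 * t2,
        t0 * t1 - t1 * t0} \<union>
       range (\<lambda>i. (gen i - scalar q) * (gen i + scalar (inverse q))))"

text \<open>
  No generators for the inverses of the \<open>T\<^sub>i\<close> are needed: for \<open>q \<noteq> 0\<close> the quadratic
  relations make the \<open>T\<^sub>i\<close> invertible, see \<open>T_Units\<close> below.
\<close>

definition affine_hecke_G2 :: "complex \<Rightarrow> (complex, node free_alg set) module" where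
  "affine_hecke_G2 q = presented_algebra (hecke_relations q)"

definition T :: "complex \<Rightarrow> node \<Rightarrow> node free_alg set" where
  "T q i = presented_gen (hecke_relations q) i"

definition hecke_G2 :: "complex \<Rightarrow> (complex, node free_alg set) module" where
  "hecke_G2 q = generated_subalgebra (affine_hecke_G2 q) {T q N1, T q N2}"


section \<open>Well-formedness of the constructions\<close>

lemma cring_complex_field: "cring complex_field"
proof (intro cringI abelian_groupI comm_monoidI)
  fix x assume "x \<in> carrier complex_field"
  then show "\<exists>y\<in>carrier complex_field. y \<oplus>\<^bsub>complex_field\<^esub> x = \<zero>\<^bsub>complex_field\<^esub>"
    by (intro bexI[of _ "- x"]) (auto simp: complex_field_def)
qed (auto simp: complex_field_def algebra_simps)

lemma free_algebra_simps [simp]: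
  "carrier free_algebra = UNIV" "monoid.mult free_algebra = (*)" "one free_algebra = 1"
  "zero free_algebra = 0" "add free_algebra = (+)" "smult free_algebra c x = scalar c * x"
  by (simp_all add: free_algebra_def)

lemma ring_free_algebra: "ring (free_algebra :: (complex, 'g free_alg) module)"
proof (intro ringI abelian_groupI monoidI)
  fix x :: "'g free_alg"
  show "\<exists>y\<in>carrier free_algebra. y \<oplus>\<^bsub>free_algebra\<^esub> x = \<zero>\<^bsub>free_algebra\<^esub>"
    by (intro bexI[of _ "- x"]) auto
qed (auto simp: algebra_simps)

lemma scalar_mult: "scalar (c * d) = scalar c * scalar d"
  by (simp add: scalar_def mult_single)

lemma scalar_add: "scalar (c + d) = scalar c + scalar d"
  by (simp add: scalar_def single_add)

lemma scalar_1 [simp]: "scalar 1 = 1"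
  by (simp add: scalar_def)

lemma scalar_commute: "x * scalar c = scalar c * x"
proof (induction x rule: update_induct)
  case const
  then show ?case by simp
next
  case (update f a b)
  have "Poly_Mapping.update a b f = f + Poly_Mapping.single a b"
    using update by (intro poly_mapping_eqI)
      (auto simp: lookup_update lookup_add lookup_single in_keys_iff when_def)
  moreover have "Poly_Mapping.single a b * scalar c = scalar c * Poly_Mapping.single a b"
    by (simp add: scalar_def mult_single mult.commute)
  ultimately show ?case
    using update by (simp add: distrib_left distrib_right)
qed

lemma complex_algebra_free_algebra: "complex_algebra free_algebra"
proof (intro complex_algebra.intro complex_algebra_axioms.intro moduleI ring_free_algebra
    cring_complex_field ring.is_abelian_group)
  fix x y :: "'g free_alg" and c
  show "x \<otimes>\<^bsub>free_algebra\<^esub> (c \<odot>\<^bsub>free_algebra\<^esub> y) = c \<odot>\<^bsub>free_algebra\<^esub> (x \<otimes>\<^bsub>free_algebra\<^esub> y)"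
    by (simp flip: mult.assoc add: scalar_commute)
qed (auto simp: complex_field_def algebra_simps scalar_mult scalar_add)

lemma quotient_algebra_simps [simp]:
  "carrier (quotient_algebra A I) = carrier (A Quot I)"
  "monoid.mult (quotient_algebra A I) = monoid.mult (A Quot I)"
  "one (quotient_algebra A I) = one (A Quot I)"
  "zero (quotient_algebra A I) = zero (A Quot I)"
  "add (quotient_algebra A I) = add (A Quot I)"
  by (simp_all add: quotient_algebra_def ring.defs module.defs)

lemma smult_quotient_algebra:
  "c \<odot>\<^bsub>quotient_algebra A I\<^esub> X = (\<Union>x\<in>X. I +>\<^bsub>A\<^esub> (c \<odot>\<^bsub>A\<^esub> x))"
  by (simp add: quotient_algebra_def ring.defs module.defs)

lemma (in complex_algebra) smult_rcos:
  assumes I: "ideal I A" and x: "x \<in> carrier A"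
  shows "c \<odot>\<^bsub>quotient_algebra A I\<^esub> (I +> x) = I +> (c \<odot> x)"
proof -
  interpret I: ideal I A by fact
  have c: "c \<in> carrier complex_field" by (simp add: complex_field_def)
  have "I +> (c \<odot> y) = I +> (c \<odot> x)" if "y \<in> I +> x" for y
  proof -
    from that obtain h where h: "h \<in> I" "y = h \<oplus> x"
      by (auto simp: a_r_coset_def')
    have hA: "h \<in> carrier A" using h I.a_subset by auto
    have "c \<odot> h = (c \<odot> \<one>) \<otimes> h"
      using smult_mult_left[of \<one> h c] hA by simp
    then have "c \<odot> h \<in> I"
      using I.I_l_closed[OF h(1), of "c \<odot> \<one>"] c by simp
    moreover have "c \<odot> y = c \<odot> h \<oplus> c \<odot> x"
      using h hA x c by (simp add: smult_r_distr)
    ultimately have "c \<odot> y \<in> I +> (c \<odot> x)"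
      by (auto simp: a_r_coset_def')
    then show ?thesis
      using I.a_repr_independence' x c by (metis smult_closed)
  qed
  moreover have "x \<in> I +> x" using x by (rule I.a_rcos_self)
  ultimately show ?thesis
    unfolding smult_quotient_algebra by blast
qed

lemma (in complex_algebra) ring_quotient_algebra:
  assumes "ideal I A"
  shows "ring (quotient_algebra A I)"
proof -
  interpret Q: ring "A Quot I" using assms by (rule ideal.quotient_is_ring)
  show ?thesis
    by (intro ringI abelian_groupI monoidI)
      (simp_all add: Q.m_assoc Q.l_distr Q.r_distr Q.a_ac Q.add.l_inv_ex)
qed

lemma (in complex_algebra) complex_algebra_quotient_algebra:
  assumes I: "ideal I A"
  shows "complex_algebra (quotient_algebra A I)"
proof -
  interpret I: ideal I A by fact
  interpret Q: ring "quotient_algebra A I" by (rule ring_quotient_algebra) fact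
  have c [simp]: "c \<in> carrier complex_field" for c by (simp add: complex_field_def)
  have carE: thesis if "X \<in> carrier (quotient_algebra A I)"
    and "\<And>x. \<lbrakk>x \<in> carrier A; X = I +> x\<rbrakk> \<Longrightarrow> thesis" for X thesis
    using that by (auto simp: FactRing_def A_RCOSETS_def')
  have mem: "I +> x \<in> carrier (quotient_algebra A I)" if "x \<in> carrier A" for x
    using that by (auto simp: FactRing_def A_RCOSETS_def')
  have add: "(I +> x) \<oplus>\<^bsub>quotient_algebra A I\<^esub> (I +> y) = I +> (x \<oplus> y)"
    if "x \<in> carrier A" "y \<in> carrier A" for x y
    using that by (simp add: FactRing_def I.a_rcos_sum)
  have mult: "(I +> x) \<otimes>\<^bsub>quotient_algebra A I\<^esub> (I +> y) = I +> (x \<otimes> y)"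
    if "x \<in> carrier A" "y \<in> carrier A" for x y
    using that by (simp add: FactRing_def I.rcoset_mult_add)
  note smult = smult_rcos[OF I]
  note [simp del] = quotient_algebra_simps
  show ?thesis
  proof (intro complex_algebra.intro complex_algebra_axioms.intro moduleI
      cring_complex_field Q.ring_axioms Q.abelian_group_axioms)
  qed (elim carE; simp add: mem add mult smult smult_l_distr smult_r_distr smult_assoc1
        smult_mult_left smult_mult_right)+
qed

lemma ideal_genideal_free_algebra: "ideal (Idl\<^bsub>free_algebra\<^esub> R) free_algebra"
  by (rule ring.genideal_ideal[OF ring_free_algebra]) simp

lemma complex_algebra_presented_algebra: "complex_algebra (presented_algebra R)"
  unfolding presented_algebra_def
  by (intro complex_algebra.complex_algebra_quotient_algebra complex_algebra_free_algebra
      ideal_genideal_free_algebra)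

lemma complex_algebra_affine_hecke_G2: "complex_algebra (affine_hecke_G2 q)"
  unfolding affine_hecke_G2_def by (rule complex_algebra_presented_algebra)

lemma presented_algebra_hom:
  "(\<lambda>x. Idl\<^bsub>free_algebra\<^esub> R +>\<^bsub>free_algebra\<^esub> x) \<in> alg_hom free_algebra (presented_algebra R)"
proof -
  let ?I = "Idl\<^bsub>free_algebra\<^esub> R"
  interpret I: ideal ?I free_algebra by (rule ideal_genideal_free_algebra)
  have "?I +>\<^bsub>free_algebra\<^esub> (scalar c * x) =
      c \<odot>\<^bsub>quotient_algebra free_algebra ?I\<^esub> (?I +>\<^bsub>free_algebra\<^esub> x)" for c x
    using complex_algebra.smult_rcos[OF complex_algebra_free_algebra I.ideal_axioms, of x c]
    by simp
  then show ?thesis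
    using I.rcos_ring_hom
    by (simp add: alg_hom_def ring_hom_def presented_algebra_def Pi_def)
qed

lemma presented_algebra_eqI:
  assumes "x - y \<in> R"
  shows "Idl\<^bsub>free_algebra\<^esub> R +>\<^bsub>free_algebra\<^esub> x = Idl\<^bsub>free_algebra\<^esub> R +>\<^bsub>free_algebra\<^esub> y"
proof -
  let ?I = "Idl\<^bsub>free_algebra\<^esub> R"
  interpret I: ideal ?I free_algebra by (rule ideal_genideal_free_algebra)
  have "x - y \<in> ?I"
    using assms ring.genideal_self[OF ring_free_algebra, of R] by auto
  then have "x \<in> ?I +>\<^bsub>free_algebra\<^esub> y"
    unfolding a_r_coset_def' by (auto intro!: bexI[of _ "x - y"])
  then show ?thesis
    using I.a_repr_independence'[of x y] by simp
qed

context
  fixes q :: complex and H (structure)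
  defines "H \<equiv> affine_hecke_G2 q"
begin

interpretation complex_algebra H
  unfolding H_def by (rule complex_algebra_affine_hecke_G2)

definition hecke_proj :: "node free_alg \<Rightarrow> node free_alg set" where
  "hecke_proj x = Idl\<^bsub>free_algebra\<^esub> (hecke_relations q) +>\<^bsub>free_algebra\<^esub> x"

lemma hecke_proj:
  "hecke_proj x \<in> carrier H" "hecke_proj (x * y) = hecke_proj x \<otimes> hecke_proj y" "hecke_proj (x + y) = hecke_proj x \<oplus> hecke_proj y"
  "hecke_proj 1 = \<one>" "hecke_proj (scalar c * x) = c \<odot> hecke_proj x" "hecke_proj (gen i) = T q i"
  using presented_algebra_hom[of "hecke_relations q"]
  by (auto simp: alg_hom_def ring_hom_def H_def affine_hecke_G2_def hecke_proj_def T_def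
      presented_gen_def)

lemma T_closed: "T q i \<in> carrier H"
  using hecke_proj(1)[of "gen i"] by (simp add: hecke_proj(6))

lemma hecke_proj_eqI: "x - y \<in> hecke_relations q \<Longrightarrow> hecke_proj x = hecke_proj y"
  unfolding hecke_proj_def by (rule presented_algebra_eqI)

lemma T_braid:
  "T q N1 \<otimes> T q N2 \<otimes> T q N1 \<otimes> T q N2 \<otimes> T q N1 \<otimes> T q N2
     = T q N2 \<otimes> T q N1 \<otimes> T q N2 \<otimes> T q N1 \<otimes> T q N2 \<otimes> T q N1"
  "T q N0 \<otimes> T q N2 \<otimes> T q N0 = T q N2 \<otimes> T q N0 \<otimes> T q N2"
  "T q N0 \<otimes> T q N1 = T q N1 \<otimes> T q N0"
  unfolding hecke_proj(2,6)[symmetric]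
  by (rule hecke_proj_eqI, simp add: hecke_relations_def Let_def)+

lemma T_quadratic:
  "(T q i \<ominus> q \<odot> \<one>) \<otimes> (T q i \<oplus> inverse q \<odot> \<one>) = \<zero>"
proof -
  have scal: "hecke_proj (scalar c) = c \<odot> \<one>" for c
    using hecke_proj(5)[of c 1] by (simp add: hecke_proj(4))
  have "hecke_proj (gen i - scalar q) \<oplus> hecke_proj (scalar q) = T q i"
    by (simp flip: hecke_proj(3) add: hecke_proj(6))
  then have minus: "hecke_proj (gen i - scalar q) = T q i \<ominus> q \<odot> \<one>"
    using hecke_proj(1)[of "gen i - scalar q"] hecke_proj(1)[of "scalar q"]
    by (metis scal a_minus_def add.inv_solve_right' T_closed)
  have "hecke_proj 0 \<oplus> hecke_proj 0 = hecke_proj 0"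
    by (simp flip: hecke_proj(3))
  then have "hecke_proj 0 = \<zero>"
    using hecke_proj(1)[of 0] by simp
  moreover have "hecke_proj ((gen i - scalar q) * (gen i + scalar (inverse q))) = hecke_proj 0"
    by (rule hecke_proj_eqI) (auto simp: hecke_relations_def Let_def)
  ultimately show ?thesis
    by (simp add: hecke_proj(2,3,6) minus scal)
qed

lemma T_Units:
  assumes "q \<noteq> 0"
  shows "T q i \<in> Units H"
proof -
  let ?t = "gen i :: node free_alg"
  let ?u = "?t + scalar (inverse q) - scalar q"
  have 1: "scalar q * scalar (inverse q) = (1 :: node free_alg)"
    using assms by (simp flip: scalar_mult)
  have eq: "(?t - scalar q) * (?t + scalar (inverse q)) = ?t * ?u - 1"
    using 1 by (simp add: algebra_simps scalar_commute[of ?t])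
  have comm: "?u * ?t = ?t * ?u"
    by (simp add: algebra_simps scalar_commute[of ?t])
  have "?t * ?u - 1 \<in> hecke_relations q"
    unfolding eq[symmetric] by (auto simp: hecke_relations_def Let_def)
  then have "hecke_proj (?t * ?u) = hecke_proj 1" "hecke_proj (?u * ?t) = hecke_proj 1"
    unfolding comm by (simp_all add: hecke_proj_eqI)
  then have "T q i \<otimes> hecke_proj ?u = \<one>" "hecke_proj ?u \<otimes> T q i = \<one>"
    by (simp_all only: hecke_proj(2,4,6))
  then show ?thesis
    using T_closed hecke_proj(1)[of ?u] by (auto simp: Units_def)
qed

end

lemma (in complex_algebra) is_subalgebra_generated_subalgebra:
  assumes "S \<subseteq> carrier A"
  shows "is_subalgebra A (carrier (generated_subalgebra A S))"
proof -
  have "is_subalgebra A (carrier A)"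
    by (simp add: is_subalgebra_def carrier_is_subring complex_field_def smult_closed)
  with assms have "{V. is_subalgebra A V \<and> S \<subseteq> V} \<noteq> {}" by blast
  moreover from this have "subring (\<Inter>{V. is_subalgebra A V \<and> S \<subseteq> V}) A"
    by (intro subring_Inter) (auto simp: is_subalgebra_def)
  ultimately show ?thesis
    by (auto simp: generated_subalgebra_def is_subalgebra_def)
qed

lemma (in complex_algebra) complex_algebra_subalgebra:
  assumes "is_subalgebra A V"
  shows "complex_algebra (A\<lparr>carrier := V\<rparr>)"
proof -
  have V: "subring V A" and smult: "\<And>c x. x \<in> V \<Longrightarrow> c \<odot> x \<in> V"
    using assms by (auto simp: is_subalgebra_def)
  interpret V: ring "A\<lparr>carrier := V\<rparr>" by (rule subring_is_ring) fact
  have [simp]: "x \<in> V \<Longrightarrow> x \<in> carrier A" for x using subringE(1)[OF V] by blast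
  have [simp]: "c \<in> carrier complex_field" for c by (simp add: complex_field_def)
  show ?thesis
    by (intro complex_algebra.intro complex_algebra_axioms.intro moduleI
        cring_complex_field V.ring_axioms V.abelian_group_axioms)
      (simp_all add: smult smult_l_distr smult_r_distr smult_assoc1 smult_mult_left smult_mult_right)
qed

lemma complex_algebra_hecke_G2: "complex_algebra (hecke_G2 q)"
  and T_in_hecke_G2: "T q N1 \<in> carrier (hecke_G2 q)" "T q N2 \<in> carrier (hecke_G2 q)"
proof -
  interpret complex_algebra "affine_hecke_G2 q" by (rule complex_algebra_affine_hecke_G2)
  have "is_subalgebra (affine_hecke_G2 q) (carrier (hecke_G2 q))"
    unfolding hecke_G2_def
    by (rule is_subalgebra_generated_subalgebra) (simp add: T_closed)
  then have "complex_algebra (affine_hecke_G2 q\<lparr>carrier := carrier (hecke_G2 q)\<rparr>)"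
    by (rule complex_algebra_subalgebra)
  then show "complex_algebra (hecke_G2 q)"
    by (simp add: hecke_G2_def generated_subalgebra_def)
  show "T q N1 \<in> carrier (hecke_G2 q)" "T q N2 \<in> carrier (hecke_G2 q)"
    by (auto simp: hecke_G2_def generated_subalgebra_def)
qed

end

theory Submission
  imports Defs "HOL-Analysis.Cartesian_Space"
begin

text \<open>
  The \<open>q\<close>-deformed reflection representation of the affine Weyl group is a three-dimensional
  representation of the affine Hecke algebra in which \<open>T\<^sub>1\<close> and \<open>T\<^sub>2\<close> preserve the plane spanned
  by the first two simple roots. Hence the whole subalgebra \<open>H(G\<^sub>2)\<close> acts on this plane, on
  which \<open>T\<^sub>1\<close> is diagonalizable with the distinct eigenvalues \<open>q\<close> and \<open>-q\<^sup>-\<^sup>1\<close>. If \<open>\<Phi>\<close> exists,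
  then \<open>\<Phi>(T\<^sub>0)\<close> acts on the plane by an operator commuting with \<open>T\<^sub>1\<close> and satisfying the
  quadratic relation, which leaves only \<open>q\<close>, \<open>-q\<^sup>-\<^sup>1\<close>, \<open>T\<^sub>1\<close> and \<open>-T\<^sub>1\<^sup>-\<^sup>1\<close>. None of these
  satisfies the braid relation of length three with \<open>T\<^sub>2\<close>.
\<close>

section \<open>Matrix representations of free algebras\<close>

lemma mat_mult: "mat c ** A = (\<chi> i j. c * A $ i $ j)" "A ** mat c = (\<chi> i j. A $ i $ j * c)"
  for A :: "'a::semiring_1 ^ 'n::finite ^ 'n"
  by (simp_all add: matrix_matrix_mult_def mat_def vec_eq_iff if_distrib if_distribR
      sum.delta sum.delta' cong: if_cong)

definition word_mat :: "('g \<Rightarrow> complex ^ 'n ^ 'n) \<Rightarrow> 'g word \<Rightarrow> complex ^ 'n ^ 'n::finite" where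
  "word_mat \<rho> w = foldr (\<lambda>g A. \<rho> g ** A) (letters w) (mat 1)"

lemma word_mat_0: "word_mat \<rho> 0 = mat 1"
  by (simp add: word_mat_def zero_word_def)

lemma word_mat_add: "word_mat \<rho> (u + v) = word_mat \<rho> u ** word_mat \<rho> v"
proof -
  have "foldr (\<lambda>g A. \<rho> g ** A) xs B = foldr (\<lambda>g A. \<rho> g ** A) xs (mat 1) ** B" for xs B
    by (induction xs) (simp_all flip: matrix_mul_assoc)
  then show ?thesis
    by (simp add: word_mat_def plus_word_def)
qed

definition mat_rep :: "('g \<Rightarrow> complex ^ 'n ^ 'n) \<Rightarrow> 'g free_alg \<Rightarrow> complex ^ 'n ^ 'n::finite" where
  "mat_rep \<rho> f = (\<Sum>w\<in>Poly_Mapping.keys f. mat (Poly_Mapping.lookup f w) ** word_mat \<rho> w)"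

lemma mat_rep_superset:
  assumes "finite S" "Poly_Mapping.keys f \<subseteq> S"
  shows "mat_rep \<rho> f = (\<Sum>w\<in>S. mat (Poly_Mapping.lookup f w) ** word_mat \<rho> w)"
  unfolding mat_rep_def using assms
  by (intro sum.mono_neutral_left) (auto simp: in_keys_iff mat_mult vec_eq_iff)

lemma mat_rep_single: "mat_rep \<rho> (Poly_Mapping.single w c) = mat c ** word_mat \<rho> w"
  by (subst mat_rep_superset[of "{w}"]) (auto simp: lookup_single)

lemma mat_rep_add: "mat_rep \<rho> (f + g) = mat_rep \<rho> f + mat_rep \<rho> g"
proof -
  let ?S = "Poly_Mapping.keys f \<union> Poly_Mapping.keys g"
  have "Poly_Mapping.keys (f + g) \<subseteq> ?S" by (rule keys_add)
  then show ?thesis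
    by (simp add: mat_rep_superset[of ?S] lookup_add mat_mult distrib_right vec_eq_iff
        flip: sum.distrib)
qed

lemma free_alg_induct [case_names single add]:
  assumes single: "\<And>w c. P (Poly_Mapping.single w c)"
    and add: "\<And>f g. P f \<Longrightarrow> P g \<Longrightarrow> P (f + g)"
  shows "P (f :: 'g free_alg)"
proof (induction f rule: update_induct)
  case const
  show ?case using single[of 0 0] by simp
next
  case (update f a b)
  have "Poly_Mapping.update a b f = f + Poly_Mapping.single a b"
    using update by (intro poly_mapping_eqI)
      (auto simp: lookup_update lookup_add lookup_single in_keys_iff when_def)
  with update show ?case by (simp add: single add)
qed

lemma mat_rep_mult:
  fixes \<rho> :: "'g \<Rightarrow> complex ^ 'n ^ 'n"
  shows "mat_rep \<rho> (f * g) = mat_rep \<rho> f ** mat_rep \<rho> g"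
proof (induction f rule: free_alg_induct)
  case (single u c)
  show ?case
  proof (induction g rule: free_alg_induct)
    case (single v d)
    have "mat c ** A ** (mat d ** B) = mat (c * d) ** (A ** B)" for A B :: "complex ^ 'n ^ 'n"
      by (simp add: mat_mult) (simp add: matrix_matrix_mult_def vec_eq_iff sum_distrib_left ac_simps)
    then show ?case
      by (simp add: mult_single mat_rep_single word_mat_add)
  next
    case (add f g)
    then show ?case by (simp add: distrib_left mat_rep_add matrix_add_ldistrib)
  qed
next
  case (add f g)
  then show ?case by (simp add: distrib_right mat_rep_add matrix_matrix_mult_def vec_eq_iff
        sum.distrib)
qed

lemma mat_rep_scalar: "mat_rep \<rho> (scalar c) = mat c"
  by (simp add: scalar_def mat_rep_single word_mat_0)

lemma mat_rep_1: "mat_rep \<rho> 1 = mat 1"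
  using mat_rep_scalar[of \<rho> 1] by simp

lemma mat_rep_gen: "mat_rep \<rho> (gen g) = \<rho> g"
  by (simp add: gen_def mat_rep_single word_mat_def)

lemma mat_rep_0: "mat_rep \<rho> 0 = 0"
  by (simp add: mat_rep_def)

lemma mat_rep_diff: "mat_rep \<rho> (f - g) = mat_rep \<rho> f - mat_rep \<rho> g"
  using mat_rep_add[of \<rho> "f - g" g] by simp

lemma ideal_mat_rep_kernel: "ideal {f. mat_rep \<rho> f = 0} free_algebra"
proof -
  interpret ring free_algebra by (rule ring_free_algebra)
  show ?thesis
  proof (intro idealI ring_free_algebra add.subgroupI)
    fix f assume f: "f \<in> {f. mat_rep \<rho> f = 0}"
    have "\<ominus>\<^bsub>free_algebra\<^esub> f = - f"
      by (rule minus_equality) simp_all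
    then show "\<ominus>\<^bsub>free_algebra\<^esub> f \<in> {f. mat_rep \<rho> f = 0}"
      using f mat_rep_diff[of \<rho> 0 f] by (simp add: mat_rep_0)
  qed (auto simp: mat_rep_add mat_rep_mult intro: exI[of _ 0] mat_rep_0)
qed

lemma mat_rep_eq_if_coset_eq:
  assumes R: "\<And>r. r \<in> R \<Longrightarrow> mat_rep \<rho> r = 0"
    and eq: "Idl\<^bsub>free_algebra\<^esub> R +>\<^bsub>free_algebra\<^esub> x = Idl\<^bsub>free_algebra\<^esub> R +>\<^bsub>free_algebra\<^esub> y"
  shows "mat_rep \<rho> x = mat_rep \<rho> y"
proof -
  interpret I: ideal "Idl\<^bsub>free_algebra\<^esub> R" free_algebra
    by (rule ideal_genideal_free_algebra)
  have "x \<in> Idl\<^bsub>free_algebra\<^esub> R +>\<^bsub>free_algebra\<^esub> y"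
    using I.a_rcos_self[of x] eq by simp
  then obtain h where h: "h \<in> Idl\<^bsub>free_algebra\<^esub> R" "x = h + y"
    by (auto simp: a_r_coset_def')
  have "Idl\<^bsub>free_algebra\<^esub> R \<subseteq> {f. mat_rep \<rho> f = 0}"
    using R by (intro ring.genideal_minimal ring_free_algebra ideal_mat_rep_kernel) auto
  with h show ?thesis by (auto simp: mat_rep_add)
qed

section \<open>The reflection representation\<close>

text \<open>The basis is \<open>e\<^sub>1, e\<^sub>2, e\<^sub>0\<close>, and matrices act on column vectors.\<close>

fun refl_rep :: "complex \<Rightarrow> node \<Rightarrow> complex ^ 3 ^ 3" where
  "refl_rep q N1 =
     vector [vector [- inverse q, 3, 0], vector [0, q, 0], vector [0, 0, q]]"
| "refl_rep q N2 =
     vector [vector [q, 0, 0], vector [1, - inverse q, 1], vector [0, 0, q]]"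
| "refl_rep q N0 =
     vector [vector [q, 0, 0], vector [0, q, 0], vector [0, 1, - inverse q]]"

lemma matrix_3_eq_iff:
  "A = B \<longleftrightarrow> A $ 1 $ 1 = B $ 1 $ 1 \<and> A $ 1 $ 2 = B $ 1 $ 2 \<and> A $ 1 $ 3 = B $ 1 $ 3 \<and>
    A $ 2 $ 1 = B $ 2 $ 1 \<and> A $ 2 $ 2 = B $ 2 $ 2 \<and> A $ 2 $ 3 = B $ 2 $ 3 \<and>
    A $ 3 $ 1 = B $ 3 $ 1 \<and> A $ 3 $ 2 = B $ 3 $ 2 \<and> A $ 3 $ 3 = B $ 3 $ 3"
  for A B :: "'a ^ 3 ^ 3"
  by (auto simp: vec_eq_iff forall_3)

lemma matrix_mult_3_nth:
  "(A ** B) $ i $ j = A $ i $ 1 * B $ 1 $ j + A $ i $ 2 * B $ 2 $ j + A $ i $ 3 * B $ 3 $ j"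
  for A B :: "'a::semiring_1 ^ 3 ^ 3"
  by (simp add: matrix_matrix_mult_def sum_3)

lemma refl_rep_quadratic:
  assumes "q \<noteq> 0"
  shows "(refl_rep q i - mat q) ** (refl_rep q i + mat (inverse q)) = 0"
  using assms by (cases i) (simp_all add: matrix_3_eq_iff matrix_mult_3_nth mat_def algebra_simps)

lemma refl_rep_braid:
  assumes "q \<noteq> 0"
  shows "refl_rep q N0 ** refl_rep q N1 = refl_rep q N1 ** refl_rep q N0"
    and "refl_rep q N0 ** refl_rep q N2 ** refl_rep q N0 =
      refl_rep q N2 ** refl_rep q N0 ** refl_rep q N2"
    and "refl_rep q N1 ** refl_rep q N2 ** refl_rep q N1 ** refl_rep q N2 ** refl_rep q N1 **
        refl_rep q N2 =
      refl_rep q N2 ** refl_rep q N1 ** refl_rep q N2 ** refl_rep q N1 ** refl_rep q N2 **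
        refl_rep q N1"
  using assms by (simp_all add: matrix_3_eq_iff matrix_mult_3_nth field_simps)

lemma mat_rep_hecke_relations:
  assumes "q \<noteq> 0" "r \<in> hecke_relations q"
  shows "mat_rep (refl_rep q) r = 0"
  using assms(2) refl_rep_braid[OF assms(1)] refl_rep_quadratic[OF assms(1)]
  by (auto simp: hecke_relations_def Let_def mat_rep_diff mat_rep_add mat_rep_mult mat_rep_gen
      mat_rep_scalar)

lemma mat_rep_eq_if_hecke_proj_eq:
  assumes "q \<noteq> 0" "hecke_proj q x = hecke_proj q y"
  shows "mat_rep (refl_rep q) x = mat_rep (refl_rep q) y"
  using assms(2) mat_rep_hecke_relations[OF assms(1)] unfolding hecke_proj_def
  by (intro mat_rep_eq_if_coset_eq) auto

text \<open>The third row says that the plane spanned by \<open>e\<^sub>1\<close> and \<open>e\<^sub>2\<close> is preserved.\<close>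

lemma hecke_G2_preserves_plane:
  assumes "X \<in> carrier (hecke_G2 q)"
  obtains x where "X = hecke_proj q x"
    "mat_rep (refl_rep q) x $ 3 $ 1 = 0" "mat_rep (refl_rep q) x $ 3 $ 2 = 0"
proof -
  let ?H = "affine_hecke_G2 q" and ?\<rho> = "mat_rep (refl_rep q)"
  interpret complex_algebra ?H by (rule complex_algebra_affine_hecke_G2)
  note proj = hecke_proj[of q]
  define P where "P = {x. ?\<rho> x $ 3 $ 1 = 0 \<and> ?\<rho> x $ 3 $ 2 = 0}"
  have P_mult: "x * y \<in> P" and P_add: "x + y \<in> P" if "x \<in> P" "y \<in> P" for x y
    using that by (auto simp: P_def mat_rep_mult mat_rep_add matrix_mult_3_nth)
  have P_scalar: "scalar c \<in> P" for c
    by (simp add: P_def mat_rep_scalar mat_def)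
  have P_gen: "gen N1 \<in> P" "gen N2 \<in> P"
    by (simp_all add: P_def mat_rep_gen)
  let ?V = "hecke_proj q ` P"
  have proj_0: "hecke_proj q 0 = \<zero>\<^bsub>?H\<^esub>"
  proof -
    have "hecke_proj q 0 \<oplus>\<^bsub>?H\<^esub> hecke_proj q 0 = hecke_proj q 0"
      by (simp flip: proj(3))
    then show ?thesis using proj(1)[of 0] by simp
  qed
  have "subring ?V ?H"
  proof (rule subringI)
    show "?V \<subseteq> carrier ?H" using proj(1) by auto
    show "\<one>\<^bsub>?H\<^esub> \<in> ?V" using P_scalar[of 1] proj(4) by (metis image_eqI scalar_1)
  next
    fix X assume "X \<in> ?V"
    then obtain x where x: "x \<in> P" "X = hecke_proj q x" by auto
    have "hecke_proj q (scalar (-1) * x) \<oplus>\<^bsub>?H\<^esub> X = hecke_proj q ((scalar (-1) + scalar 1) * x)"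
      by (simp add: x(2) distrib_right proj(3))
    also have "\<dots> = \<zero>\<^bsub>?H\<^esub>"
      by (simp only: scalar_add[symmetric]) (simp add: scalar_def proj_0)
    finally have "\<ominus>\<^bsub>?H\<^esub> X = hecke_proj q (scalar (-1) * x)"
      using x(2) proj(1) by (intro minus_equality) auto
    then show "\<ominus>\<^bsub>?H\<^esub> X \<in> ?V" using x P_mult P_scalar by auto
  qed (auto simp flip: proj(2,3) intro: P_mult P_add)
  then have "is_subalgebra ?H ?V"
    using P_mult P_scalar by (auto simp: is_subalgebra_def simp flip: proj(5))
  moreover have "{T q N1, T q N2} \<subseteq> ?V"
    using P_gen by (auto simp flip: proj(6))
  ultimately have "X \<in> ?V"
    using assms by (auto simp: hecke_G2_def generated_subalgebra_def)
  then show ?thesis using that by (auto simp: P_def)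
qed

section \<open>The non-existence of an evaluation homomorphism\<close>

lemma no_braid_partner_on_plane:
  fixes q :: complex and X :: "complex ^ 3 ^ 3"
  assumes q: "q \<noteq> 0" "q ^ 4 \<noteq> 1"
    and plane: "X $ 3 $ 1 = 0" "X $ 3 $ 2 = 0"
    and quadratic: "(X - mat q) ** (X + mat (inverse q)) = 0"
    and comm: "X ** refl_rep q N1 = refl_rep q N1 ** X"
    and braid: "X ** refl_rep q N2 ** X = refl_rep q N2 ** X ** refl_rep q N2"
  shows False
proof -
  define r where "r = inverse q"
  have qr: "q * r = 1" using q by (simp add: r_def)
  have "q ^ 4 = (q\<^sup>2)\<^sup>2" by (simp flip: power_mult)
  then have "q\<^sup>2 \<noteq> 1" "q\<^sup>2 \<noteq> -1" using q(2) by (metis one_power2 power2_minus)+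
  then have qr': "q \<noteq> r" "q + r \<noteq> 0"
    using qr by (auto simp: power2_eq_square add_eq_0_iff minus_equation_iff[of "q * q"])
  define a b c d where "a = X $ 1 $ 1" "b = X $ 1 $ 2" "c = X $ 2 $ 1" "d = X $ 2 $ 2"
  note defs = this
  have "c = 0" and b: "(q + r) * b = 3 * (d - a)"
    using comm plane by (auto simp: matrix_3_eq_iff matrix_mult_3_nth defs r_def algebra_simps)
  have quad: "(a - q) * (a + r) = 0" "(d - q) * (d + r) = 0"
    using quadratic plane \<open>c = 0\<close>
    by (auto simp: matrix_3_eq_iff matrix_mult_3_nth defs r_def mat_def algebra_simps)
  have key: "d * a = q * a + b - r * d"
    using braid plane \<open>c = 0\<close>
    by (auto simp: matrix_3_eq_iff matrix_mult_3_nth defs r_def algebra_simps)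
  consider "a = q" "d = q" | "a = q" "d = - r" | "a = - r" "d = q" | "a = - r" "d = - r"
    using quad by (auto simp: add_eq_0_iff2)
  then show False
  proof cases
    case 1
    with b qr' have "b = 0" by simp
    with 1 key qr show False by (simp add: algebra_simps)
  next
    case 2
    have "(q + r) * b = (q + r) * (- 3)" unfolding b 2 by (simp add: algebra_simps)
    with qr' have "b = - 3" by (metis mult_left_cancel)
    with 2 have "(q - r)\<^sup>2 = (q * a + b - r * d) + 3 - 2 * (q * r)"
      by (simp add: power2_eq_square algebra_simps)
    also have "\<dots> = 0"
      unfolding key[symmetric] using 2 qr by (simp add: mult.commute[of r q])
    finally show False using qr'(1) by simp
  next
    case 3
    have "(q + r) * b = (q + r) * 3" unfolding b 3 by (simp add: algebra_simps)
    with qr' have "b = 3" by (metis mult_left_cancel)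
    with 3 key qr show False by (simp add: algebra_simps)
  next
    case 4
    with b qr' have "b = 0" by simp
    with 4 key qr show False by (simp add: algebra_simps)
  qed
qed

theorem proposition5p6:
  fixes q :: complex
  assumes "q \<noteq> 0" and "q ^ 4 \<noteq> 1"
  shows "\<not> (\<exists>\<Phi> \<in> alg_hom (affine_hecke_G2 q) (hecke_G2 q).
              \<Phi> (T q N1) = T q N1 \<and> \<Phi> (T q N2) = T q N2)"
proof
  let ?H = "affine_hecke_G2 q" and ?\<rho> = "mat_rep (refl_rep q)"
  note proj = hecke_proj[of q]
  assume "\<exists>\<Phi> \<in> alg_hom ?H (hecke_G2 q). \<Phi> (T q N1) = T q N1 \<and> \<Phi> (T q N2) = T q N2"
  then obtain \<Phi> where \<Phi>: "\<Phi> \<in> alg_hom ?H (hecke_G2 q)"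
    and fixed: "\<Phi> (T q N1) = T q N1" "\<Phi> (T q N2) = T q N2" by auto
  have hecke_G2: "mult (hecke_G2 q) = mult ?H" "add (hecke_G2 q) = add ?H"
      "smult (hecke_G2 q) = smult ?H" "\<one>\<^bsub>hecke_G2 q\<^esub> = \<one>\<^bsub>?H\<^esub>"
    by (simp_all add: hecke_G2_def generated_subalgebra_def)
  have T_closed: "T q i \<in> carrier ?H" for i by (rule T_closed)
  interpret complex_algebra ?H by (rule complex_algebra_affine_hecke_G2)
  have \<Phi>_closed: "\<Phi> X \<in> carrier (hecke_G2 q)" if "X \<in> carrier ?H" for X
    using \<Phi> that by (auto simp: alg_hom_def ring_hom_def)
  have \<Phi>_mult: "\<Phi> (X \<otimes>\<^bsub>?H\<^esub> Y) = \<Phi> X \<otimes>\<^bsub>?H\<^esub> \<Phi> Y"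
    and \<Phi>_add: "\<Phi> (X \<oplus>\<^bsub>?H\<^esub> Y) = \<Phi> X \<oplus>\<^bsub>?H\<^esub> \<Phi> Y"
    if "X \<in> carrier ?H" "Y \<in> carrier ?H" for X Y
    using \<Phi> that by (auto simp: alg_hom_def ring_hom_def hecke_G2)
  have \<Phi>_smult: "\<Phi> (c \<odot>\<^bsub>?H\<^esub> X) = c \<odot>\<^bsub>?H\<^esub> \<Phi> X" if "X \<in> carrier ?H" for X c
    using \<Phi> that by (auto simp: alg_hom_def hecke_G2)
  have \<Phi>_one: "\<Phi> \<one>\<^bsub>?H\<^esub> = \<one>\<^bsub>?H\<^esub>"
    using \<Phi> by (auto simp: alg_hom_def ring_hom_def hecke_G2)
  obtain x where x: "\<Phi> (T q N0) = hecke_proj q x"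
    and plane: "?\<rho> x $ 3 $ 1 = 0" "?\<rho> x $ 3 $ 2 = 0"
    using hecke_G2_preserves_plane[OF \<Phi>_closed[OF T_closed]] by metis
  note \<rho>_simps = mat_rep_mult mat_rep_add mat_rep_gen mat_rep_scalar
  note eqI = mat_rep_eq_if_hecke_proj_eq[OF assms(1)]
  have "hecke_proj q (x * gen N1) = hecke_proj q (gen N1 * x)"
    using arg_cong[OF T_braid(3)[of q], of \<Phi>] by (simp add: \<Phi>_mult T_closed fixed x proj)
  from eqI[OF this] have comm: "?\<rho> x ** refl_rep q N1 = refl_rep q N1 ** ?\<rho> x"
    by (simp only: \<rho>_simps)
  have "hecke_proj q (x * gen N2 * x) = hecke_proj q (gen N2 * x * gen N2)"
    using arg_cong[OF T_braid(2)[of q], of \<Phi>] by (simp add: \<Phi>_mult T_closed fixed x proj)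
  from eqI[OF this] have braid:
    "?\<rho> x ** refl_rep q N2 ** ?\<rho> x = refl_rep q N2 ** ?\<rho> x ** refl_rep q N2"
    by (simp only: \<rho>_simps)
  let ?k = "q - inverse q"
  have k: "scalar ?k = (scalar q - scalar (inverse q) :: node free_alg)"
    by (simp add: eq_diff_eq flip: scalar_add)
  have "scalar q * scalar (inverse q) = (1 :: node free_alg)"
    using assms(1) by (simp flip: scalar_mult)
  then have "gen N0 * gen N0 - (scalar ?k * gen N0 + 1) =
      (gen N0 - scalar q) * (gen N0 + scalar (inverse q))"
    unfolding k by (simp add: algebra_simps scalar_commute[of "gen N0"])
  then have "gen N0 * gen N0 - (scalar ?k * gen N0 + 1) \<in> hecke_relations q"
    by (auto simp: hecke_relations_def Let_def)
  then have "T q N0 \<otimes>\<^bsub>?H\<^esub> T q N0 = ?k \<odot>\<^bsub>?H\<^esub> T q N0 \<oplus>\<^bsub>?H\<^esub> \<one>\<^bsub>?H\<^esub>"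
    by (simp flip: proj(2-6) add: hecke_proj_eqI)
  from arg_cong[OF this, of \<Phi>] have "hecke_proj q (x * x) = hecke_proj q (scalar ?k * x + 1)"
    unfolding proj(3-5)
    by (simp add: \<Phi>_mult \<Phi>_add \<Phi>_smult \<Phi>_one T_closed smult_closed x proj(2) complex_field_def)
  from eqI[OF this] have "?\<rho> x ** ?\<rho> x = mat ?k ** ?\<rho> x + mat 1"
    by (simp only: \<rho>_simps mat_rep_1)
  then have quadratic: "(?\<rho> x - mat q) ** (?\<rho> x + mat (inverse q)) = 0"
    using assms(1) by (simp add: matrix_3_eq_iff matrix_mult_3_nth mat_def algebra_simps)
  show False
    using no_braid_partner_on_plane[OF assms plane quadratic comm braid] .
qed

end
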